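(* Consider a sequence of hub models with a null component with $n_L\to\infty$, $n\to\infty$, $T\to\infty$, satisfying the standing assumption on $\rho$ in the context. Let $d,v\in(0,1]$ (possibly depending on the index of the sequence) be such that: (i) for each $i=1,\dots,n_L$ there exists a set $V_i\subset\{1,\dots,n\}$ with $|V_i|\ge vn/n_L$ and $A_{ij}-A_{i'j}\ge d$ for all $j\in V_i$ and all $i'\in\{0,1,\dots,n_L\}$, $i'\ne i$; (ii) $A_{ii'}\le c_0/n_L$ for all $i\in\{0,\dots,n_L\}$, $i'\in\{1,\dots,n_L\}$, $i\ne i'$, where $c_0$ is a positive constant. If $(n_L^2\log n_L)/T=o(1)$, $(n_L^5\log T)/(d^2vT)=o(1)$ and $(n_L^8\log n_L)/(d^4v^2n)=o(1)$, then $$\frac{T_e}{T}=o_p(1).$$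
   Context: Hub model with a null component: nodes $1,\dots,n$; leaders (possible hubs) $1,\dots,n_L$ with $n_L\le n$; label $0$ denotes a hubless group. Parameters: $\rho=(\rho_0,\dots,\rho_{n_L})$ with $\rho_i\ge0$, $\sum_{i=0}^{n_L}\rho_i=1$, and $A=(A_{ij})_{0\le i\le n_L,1\le j\le n}$ with entries in $[0,1]$ and $A_{ii}=1$ for $1\le i\le n_L$ (row $0$ is also denoted $\pi_j=A_{0j}$). Independently for $t=1,\dots,T$, a latent label $z_*^{(t)}\in\{0,\dots,n_L\}$ is drawn with $\mathbb P(z_*^{(t)}=i)=\rho_i$, and given $z_*^{(t)}=i$ the variables $G_j^{(t)}\in\{0,1\}$, $j=1,\dots,n$, are independent with $\mathbb P(G_j^{(t)}=1\mid z_*^{(t)}=i)=A_{ij}$. Only $G$ is observed. Profile likelihood estimator: for an assignment $z=(z^{(1)},\dots,z^{(T)})\in\{0,\dots,n_L\}^T$ let $t_i=\sum_t1(z^{(t)}=i)$, $\hat A^z_{ij}=\frac1{t_i}\sum_tG_j^{(t)}1(z^{(t)}=i)$, and $$L_G(z)=\sum_{t=1}^T\sum_{j=1}^n G_j^{(t)}\log\hat A^z_{z^{(t)},j}+(1-G_j^{(t)})\log(1-\hat A^z_{z^{(t)},j}),\qquad 0\log0=0.$$ An assignment is feasible if, for every $t$, either $z^{(t)}=0$ or $G^{(t)}_{z^{(t)}}=1$. $\hat z$ is a maximizer of $L_G(z)$ over feasible assignments. $T_e=\sum_t1(z_*^{(t)}\neq\hat z^{(t)})$ is the number of mislabeled groups.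 Asymptotics: $n_L,n,T,\rho,A,d,v$ all vary along a sequence; $o(1)$ and $o_p(1)$ are along this sequence, and "constant" means independent of the sequence index. Standing assumption: $\min_{0\le i\le n_L}\rho_i=c_{\min*}/n_L$ and $\max_{0\le i\le n_L}\rho_i=c_{\max*}/n_L$ with positive constants $c_{\min*},c_{\max*}$. *)

theory Defs
  imports "HOL-Probability.Probability" "HOL-Library.Landau_Symbols"
begin

text \<open>
  Groups are indexed by \<open>{1..T}\<close>, nodes by \<open>{1..n}\<close>, leaders by \<open>{1..nL}\<close>, and label 0 is the
  hubless label. An assignment is a function \<open>nat \<Rightarrow> nat\<close> of which only the values on \<open>{1..T}\<close>
  matter. The label distribution \<open>(\<rho>\<^sub>0, \<dots>, \<rho>\<^sub>n\<^sub>L)\<close> is a pmf \<open>\<rho>\<close> supported in \<open>{0..nL}\<close>, so that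
  nonnegativity and total mass one are part of its type, and \<open>\<rho>\<^sub>i\<close> is \<open>pmf \<rho> i\<close>.
\<close>

definition hub_model :: "nat \<Rightarrow> nat \<Rightarrow> nat pmf \<Rightarrow> (nat \<Rightarrow> nat \<Rightarrow> real) \<Rightarrow> bool" where
  "hub_model nL n \<rho> A \<longleftrightarrow>
     nL \<le> n \<and> set_pmf \<rho> \<subseteq> {0..nL} \<and>
     (\<forall>i\<in>{0..nL}. \<forall>j\<in>{1..n}. 0 \<le> A i j \<and> A i j \<le> 1) \<and>
     (\<forall>i\<in>{1..nL}. A i i = 1)"

definition hub_group_pmf ::
    "nat \<Rightarrow> nat pmf \<Rightarrow> (nat \<Rightarrow> nat \<Rightarrow> real) \<Rightarrow> (nat \<times> (nat \<Rightarrow> bool)) pmf" where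
  "hub_group_pmf n \<rho> A =
     bind_pmf \<rho> (\<lambda>i. map_pmf (\<lambda>g. (i, g)) (Pi_pmf {1..n} False (\<lambda>j. bernoulli_pmf (A i j))))"

definition hub_sample_pmf ::
    "nat \<Rightarrow> nat \<Rightarrow> nat pmf \<Rightarrow> (nat \<Rightarrow> nat \<Rightarrow> real) \<Rightarrow> (nat \<Rightarrow> nat \<times> (nat \<Rightarrow> bool)) pmf" where
  "hub_sample_pmf T n \<rho> A = Pi_pmf {1..T} (0, \<lambda>_. False) (\<lambda>_. hub_group_pmf n \<rho> A)"

definition true_labels :: "(nat \<Rightarrow> nat \<times> (nat \<Rightarrow> bool)) \<Rightarrow> nat \<Rightarrow> nat" where
  "true_labels \<omega> t = fst (\<omega> t)"

definition observed_groups :: "(nat \<Rightarrow> nat \<times> (nat \<Rightarrow> bool)) \<Rightarrow> nat \<Rightarrow> nat \<Rightarrow> bool" where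
  "observed_groups \<omega> t = snd (\<omega> t)"

definition label_count :: "nat \<Rightarrow> (nat \<Rightarrow> nat) \<Rightarrow> nat \<Rightarrow> nat" where
  "label_count T z i = card {t\<in>{1..T}. z t = i}"

definition A_hat :: "nat \<Rightarrow> (nat \<Rightarrow> nat \<Rightarrow> bool) \<Rightarrow> (nat \<Rightarrow> nat) \<Rightarrow> nat \<Rightarrow> nat \<Rightarrow> real" where
  "A_hat T G z i j =
     (\<Sum>t=1..T. of_bool (G t j) * of_bool (z t = i)) / real (label_count T z i)"

text \<open>
  The convention \<open>0 log 0 = 0\<close> holds automatically, since \<open>0 * ln 0 = 0\<close> whatever \<open>ln 0\<close> is.
  A factor \<open>ln 0\<close> is never multiplied by a nonzero weight: \<open>G t j\<close> excludes
  \<open>A_hat T G z (z t) j = 0\<close>, and \<open>\<not> G t j\<close> excludes \<open>A_hat T G z (z t) j = 1\<close>.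
\<close>

definition log_lik :: "nat \<Rightarrow> nat \<Rightarrow> (nat \<Rightarrow> nat \<Rightarrow> bool) \<Rightarrow> (nat \<Rightarrow> nat) \<Rightarrow> real" where
  "log_lik T n G z =
     (\<Sum>t=1..T. \<Sum>j=1..n.
        of_bool (G t j) * ln (A_hat T G z (z t) j)
        + (1 - of_bool (G t j)) * ln (1 - A_hat T G z (z t) j))"

definition feasible :: "nat \<Rightarrow> nat \<Rightarrow> (nat \<Rightarrow> nat \<Rightarrow> bool) \<Rightarrow> (nat \<Rightarrow> nat) \<Rightarrow> bool" where
  "feasible T nL G z \<longleftrightarrow> (\<forall>t\<in>{1..T}. z t \<in> {0..nL} \<and> (z t = 0 \<or> G t (z t)))"

definition profile_mle ::
    "nat \<Rightarrow> nat \<Rightarrow> nat \<Rightarrow> (nat \<Rightarrow> nat \<Rightarrow> bool) \<Rightarrow> (nat \<Rightarrow> nat) \<Rightarrow> bool" where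
  "profile_mle T nL n G z \<longleftrightarrow> is_arg_max (log_lik T n G) (feasible T nL G) z"

definition num_mislabeled :: "nat \<Rightarrow> (nat \<Rightarrow> nat) \<Rightarrow> (nat \<Rightarrow> nat) \<Rightarrow> nat" where
  "num_mislabeled T zs z = card {t\<in>{1..T}. zs t \<noteq> z t}"

text \<open>\<open>X\<^sub>k = o\<^sub>p(1)\<close>; the \<open>X\<^sub>k\<close> may live on different probability spaces.\<close>

definition is_op_one :: "(nat \<Rightarrow> 'a measure) \<Rightarrow> (nat \<Rightarrow> 'a \<Rightarrow> real) \<Rightarrow> bool" where
  "is_op_one M X \<longleftrightarrow>
     (\<forall>\<epsilon>>0. (\<lambda>k. measure (M k) {\<omega>\<in>space (M k). \<bar>X k \<omega>\<bar> > \<epsilon>}) \<longlonglongrightarrow> 0)"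

end

(* The profile log-likelihood of z is the log-likelihood of the pair (z, A_hat z), and A_hat z takes
   values in a finite grid of fractions k / t. For a fixed assignment z and fixed parameters B, the
   square root of the likelihood ratio between (z, B) and the truth has expectation at most
   exp (- sum of (A - B)^2 / 4), by the Bhattacharyya affinity of Bernoulli laws. Markov's inequality
   and a union bound over all z and all grid values of B thus show that the maximizer has a small
   squared distance between true and fitted rows. Since the true rows are separated, each fitted row
   is close to at most one of them; a mislabeled group either pays a distance or sits in a class whose
   fitted row is close to a wrong true row. By Chernoff bounds the latter groups are few: O(T / nL^2)
   per hub class, by feasibility and the bound on A i i', and O(T / nL) in the hubless class, since
   no single label is more frequent than that. *)

theory Submission
  imports Defs
begin

section \<open>Markov and Chernoff bounds for product measures\<close>

text \<open>Markov's inequality. Stated with the nonnegative integral, it needs no integrability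
  argument, and negative values of \<open>f\<close> are cut off by \<open>ennreal\<close>.\<close>

lemma prob_le_of_nn_integral_le:
  fixes f :: "'a \<Rightarrow> real"
  assumes le: "(\<integral>\<^sup>+\<omega>. ennreal (f \<omega>) \<partial>measure_pmf p) \<le> ennreal b" and b: "0 \<le> b" and c: "0 < c"
  shows "measure_pmf.prob p {\<omega>. c \<le> f \<omega>} \<le> b / c"
proof -
  have "ennreal (measure_pmf.prob p {\<omega>. c \<le> f \<omega>}) = (\<integral>\<^sup>+\<omega>. indicator {\<omega>. c \<le> f \<omega>} \<omega> \<partial>measure_pmf p)"
    by (simp add: measure_pmf.emeasure_eq_measure)
  also have "\<dots> \<le> (\<integral>\<^sup>+\<omega>. ennreal (1 / c) * ennreal (f \<omega>) \<partial>measure_pmf p)"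
  proof (rule nn_integral_mono)
    fix \<omega>
    show "indicator {\<omega>. c \<le> f \<omega>} \<omega> \<le> ennreal (1 / c) * ennreal (f \<omega>)"
      using c by (auto simp: indicator_def ennreal_mult'[symmetric] ennreal_1[symmetric] field_simps
          simp del: ennreal_1 intro!: ennreal_leI)
  qed
  also have "\<dots> = ennreal (1 / c) * (\<integral>\<^sup>+\<omega>. ennreal (f \<omega>) \<partial>measure_pmf p)"
    by (rule nn_integral_cmult) simp
  also have "\<dots> \<le> ennreal (1 / c) * ennreal b"
    by (intro mult_left_mono le) simp
  also have "\<dots> = ennreal (b / c)"
    using b c by (simp add: ennreal_mult'[symmetric])
  finally show ?thesis
    using b c by (simp add: ennreal_le_iff)
qed

text \<open>By independence the expectation of the product is the product of the expectations, hence
  at most \<open>b ^ card I\<close>; Markov's inequality does the rest. Both the count bounds and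
  the likelihood ratio bound come from here.\<close>

lemma Pi_pmf_prob_prod_ge:
  fixes f :: "'i \<Rightarrow> 'a \<Rightarrow> real"
  assumes fin: "finite I" and nonneg: "\<And>t x. t \<in> I \<Longrightarrow> x \<in> set_pmf (p t) \<Longrightarrow> 0 \<le> f t x"
    and le: "\<And>t. t \<in> I \<Longrightarrow> (\<integral>\<^sup>+x. ennreal (f t x) \<partial>measure_pmf (p t)) \<le> ennreal b"
    and b: "0 \<le> b" and c: "0 < c"
  shows "measure_pmf.prob (Pi_pmf I dflt p) {\<omega>. c \<le> (\<Prod>t\<in>I. f t (\<omega> t))} \<le> b ^ card I / c"
proof (rule prob_le_of_nn_integral_le)
  have "(\<integral>\<^sup>+\<omega>. ennreal (\<Prod>t\<in>I. f t (\<omega> t)) \<partial>measure_pmf (Pi_pmf I dflt p))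
      = (\<integral>\<^sup>+\<omega>. (\<Prod>t\<in>I. ennreal (f t (\<omega> t))) \<partial>measure_pmf (Pi_pmf I dflt p))"
    by (intro nn_integral_cong_AE AE_pmfI prod_ennreal[symmetric] nonneg)
      (use fin in \<open>auto simp: set_Pi_pmf PiE_dflt_def\<close>)
  also have "\<dots> = (\<Prod>t\<in>I. \<integral>\<^sup>+x. ennreal (f t x) \<partial>measure_pmf (p t))"
    by (rule nn_integral_prod_Pi_pmf[OF fin])
  also have "\<dots> \<le> (\<Prod>t\<in>I. ennreal b)"
    by (intro prod_mono_ennreal le)
  also have "\<dots> = ennreal (b ^ card I)"
    using b by (simp add: ennreal_power)
  finally show "(\<integral>\<^sup>+\<omega>. ennreal (\<Prod>t\<in>I. f t (\<omega> t)) \<partial>measure_pmf (Pi_pmf I dflt p)) \<le> ennreal (b ^ card I)" .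
qed (use b c in auto)

text \<open>A Chernoff bound with exponential parameter 1. As \<open>exp 1 \<le> 3\<close>, the
  moment of one indicator is at most \<open>1 + 2 * q \<le> exp (2 * q)\<close>, so the threshold
  \<open>3 * q * card I\<close> leaves the factor \<open>exp (- (q * card I))\<close>.\<close>

lemma Pi_pmf_count_upper_tail:
  fixes q :: real
  assumes fin: "finite I" and E: "measure_pmf.prob p E \<le> q"
  shows "measure_pmf.prob (Pi_pmf I dflt (\<lambda>_. p)) {\<omega>. 3 * q * card I \<le> card {t\<in>I. \<omega> t \<in> E}}
    \<le> exp (- (q * card I))"
proof -
  have q: "0 \<le> q" using E measure_nonneg order_trans by blast
  have "(\<integral>\<^sup>+x. ennreal (exp (indicator E x)) \<partial>measure_pmf p)
      = (\<integral>\<^sup>+x. 1 + ennreal (exp 1 - 1) * indicator E x \<partial>measure_pmf p)"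
    using ennreal_plus[of 1 "exp 1 - 1"] by (intro nn_integral_cong) (auto simp: indicator_def)
  also have "\<dots> = 1 + ennreal (exp 1 - 1) * emeasure (measure_pmf p) E"
    by (simp add: nn_integral_add nn_integral_cmult)
  also have "\<dots> = ennreal (1 + (exp 1 - 1) * measure_pmf.prob p E)"
    by (simp add: measure_pmf.emeasure_eq_measure ennreal_mult' ennreal_plus)
  also have "\<dots> \<le> ennreal (exp (2 * q))"
  proof (rule ennreal_leI)
    have "(exp 1 - 1) * measure_pmf.prob p E \<le> 2 * q"
      using exp_le E q by (intro mult_mono) auto
    then show "1 + (exp 1 - 1) * measure_pmf.prob p E \<le> exp (2 * q)"
      using exp_ge_add_one_self[of "2 * q"] by linarith
  qed
  finally have le: "(\<integral>\<^sup>+x. ennreal (exp (indicator E x)) \<partial>measure_pmf p) \<le> ennreal (exp (2 * q))" .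
  have "measure_pmf.prob (Pi_pmf I dflt (\<lambda>_. p)) {\<omega>. exp (3 * q * card I) \<le> (\<Prod>t\<in>I. exp (indicator E (\<omega> t)))}
      \<le> exp (2 * q) ^ card I / exp (3 * q * card I)"
    by (rule Pi_pmf_prob_prod_ge[OF fin _ le]) auto
  also have "exp (2 * q) ^ card I / exp (3 * q * card I) = exp (- (q * card I))"
    by (simp add: exp_of_nat_mult[symmetric] exp_diff[symmetric] algebra_simps)
  also have "{\<omega>. exp (3 * q * card I) \<le> (\<Prod>t\<in>I. exp (indicator E (\<omega> t)))}
      = {\<omega>. 3 * q * card I \<le> card {t\<in>I. \<omega> t \<in> E}}"
    using fin by (simp add: exp_sum[symmetric] indicator_def sum.If_cases Int_def)
  finally show ?thesis .
qed

lemma prob_UN_le: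
  assumes "finite S" "\<And>x. x \<in> S \<Longrightarrow> measure_pmf.prob p (E x) \<le> b"
  shows "measure_pmf.prob p (\<Union>x\<in>S. E x) \<le> real (card S) * b"
proof -
  have "measure_pmf.prob p (\<Union>x\<in>S. E x) \<le> (\<Sum>x\<in>S. measure_pmf.prob p (E x))"
    by (rule measure_pmf.finite_measure_subadditive_finite) (use assms in auto)
  also have "\<dots> \<le> real (card S) * b"
    by (rule sum_bounded_above) (use assms in auto)
  finally show ?thesis .
qed

section \<open>Bhattacharyya affinity and tilted likelihood ratios\<close>

definition bern_lik :: "real \<Rightarrow> bool \<Rightarrow> real" where
  "bern_lik p g = (if g then p else 1 - p)"

text \<open>Twice the defect of the affinity from 1 is the sum of the two squared differences of
  square roots. Since \<open>x - y\<close> factors as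
  \<open>(sqrt x + sqrt y) * (sqrt x - sqrt y)\<close> with first factor at most 2, each of them is
  at least \<open>(p - q)\<^sup>2 / 4\<close>.\<close>

lemma bhattacharyya_le:
  fixes p q :: real
  assumes "0 \<le> p" "p \<le> 1" "0 \<le> q" "q \<le> 1"
  shows "sqrt (p * q) + sqrt ((1 - p) * (1 - q)) \<le> 1 - (p - q)\<^sup>2 / 4"
proof -
  have le: "(x - y)\<^sup>2 \<le> 4 * (sqrt x - sqrt y)\<^sup>2" if "0 \<le> x" "x \<le> 1" "0 \<le> y" "y \<le> 1" for x y :: real
  proof -
    have "(x - y)\<^sup>2 = (sqrt x + sqrt y)\<^sup>2 * (sqrt x - sqrt y)\<^sup>2"
      using that by (simp add: power_mult_distrib[symmetric] algebra_simps)
    also have "\<dots> \<le> 2\<^sup>2 * (sqrt x - sqrt y)\<^sup>2"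
    proof (intro mult_right_mono power_mono)
      have "sqrt x \<le> 1" "sqrt y \<le> 1" using that by auto
      then show "sqrt x + sqrt y \<le> 2" by linarith
    qed (use that in auto)
    finally show ?thesis by simp
  qed
  have exp: "(sqrt x - sqrt y)\<^sup>2 = x + y - 2 * sqrt (x * y)" if "0 \<le> x" "0 \<le> y" for x y :: real
    using that by (simp add: power2_diff real_sqrt_mult)
  have "(1 - p - (1 - q))\<^sup>2 = (p - q)\<^sup>2"
    by (simp add: power2_commute)
  then show ?thesis
    using le[of p q] le[of "1 - p" "1 - q"] exp[of p q] exp[of "1 - p" "1 - q"] assms by simp
qed

text \<open>Where the denominator vanishes the quotient is 0; such outcomes have probability 0.\<close>

definition tilt :: "real \<Rightarrow> real \<Rightarrow> bool \<Rightarrow> real" where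
  "tilt p q g = sqrt (bern_lik q g / bern_lik p g) * exp ((p - q)\<^sup>2 / 4)"

lemma bern_lik_nonneg: "0 \<le> p \<Longrightarrow> p \<le> 1 \<Longrightarrow> 0 \<le> bern_lik p g"
  by (simp add: bern_lik_def)

lemma tilt_nonneg: "0 \<le> p \<Longrightarrow> p \<le> 1 \<Longrightarrow> 0 \<le> q \<Longrightarrow> q \<le> 1 \<Longrightarrow> 0 \<le> tilt p q g"
  by (simp add: tilt_def bern_lik_def)

text \<open>The root of the likelihood ratio has the affinity as its mean, which is at most
  \<open>1 - x \<le> exp (- x)\<close> for \<open>x = (p - q)\<^sup>2 / 4\<close>. The exponential
  factor in \<open>tilt\<close> cancels exactly this decay.\<close>

lemma nn_integral_tilt_le:
  assumes "0 \<le> p" "p \<le> 1" "0 \<le> q" "q \<le> 1"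
  shows "(\<integral>\<^sup>+g. ennreal (tilt p q g) \<partial>measure_pmf (bernoulli_pmf p)) \<le> 1"
proof -
  have s: "sqrt (y / x) * x \<le> sqrt (x * y)" if "0 \<le> x" "0 \<le> y" for x y :: real
  proof (cases "x = 0")
    case False
    then have "sqrt (y / x) * x = sqrt y / sqrt x * (sqrt x * sqrt x)" "sqrt x \<noteq> 0"
      using that by (simp_all add: real_sqrt_divide)
    moreover have "sqrt y / sqrt x * (sqrt x * sqrt x) = sqrt y * sqrt x"
      using \<open>sqrt x \<noteq> 0\<close> by (simp del: real_sqrt_mult_self)
    ultimately show ?thesis by (simp add: real_sqrt_mult)
  qed simp
  have "tilt p q True * p + tilt p q False * (1 - p)
      = exp ((p - q)\<^sup>2 / 4) * (sqrt (q / p) * p + sqrt ((1 - q) / (1 - p)) * (1 - p))"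
    by (simp add: tilt_def bern_lik_def algebra_simps)
  also have "\<dots> \<le> exp ((p - q)\<^sup>2 / 4) * (sqrt (p * q) + sqrt ((1 - p) * (1 - q)))"
    using s[of p q] s[of "1 - p" "1 - q"] assms by (intro mult_left_mono add_mono) auto
  also have "\<dots> \<le> exp ((p - q)\<^sup>2 / 4) * (1 - (p - q)\<^sup>2 / 4)"
    by (intro mult_left_mono bhattacharyya_le assms) auto
  also have "\<dots> \<le> exp ((p - q)\<^sup>2 / 4) * exp (- ((p - q)\<^sup>2 / 4))"
    using exp_ge_add_one_self[of "- ((p - q)\<^sup>2 / 4)"] by (intro mult_left_mono) auto
  also have "\<dots> = 1" by (simp add: exp_minus)
  finally have le: "tilt p q True * p + tilt p q False * (1 - p) \<le> 1" .
  have "(\<integral>\<^sup>+g. ennreal (tilt p q g) \<partial>measure_pmf (bernoulli_pmf p))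
      = ennreal (tilt p q True * p + tilt p q False * (1 - p))"
    using assms by (subst nn_integral_bernoulli_pmf) (auto simp: ennreal_mult' ennreal_plus tilt_nonneg)
  also have "\<dots> \<le> 1"
    using le by (simp add: ennreal_le_1)
  finally show ?thesis .
qed

lemma hub_modelD:
  assumes "hub_model nL n \<rho> A"
  shows "\<And>i j. i \<in> {0..nL} \<Longrightarrow> j \<in> {1..n} \<Longrightarrow> 0 \<le> A i j"
    "\<And>i j. i \<in> {0..nL} \<Longrightarrow> j \<in> {1..n} \<Longrightarrow> A i j \<le> 1"
    "\<And>i. i \<in> {1..nL} \<Longrightarrow> A i i = 1" "\<And>i. i \<in> set_pmf \<rho> \<Longrightarrow> i \<in> {0..nL}" "nL \<le> n"
  using assms unfolding hub_model_def by blast+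

text \<open>The true row is selected by the label stored in the group itself, so this is a function
  of a single group and independence across groups applies. The row \<open>b\<close> is the
  competing fitted row.\<close>

definition group_tilt :: "nat \<Rightarrow> (nat \<Rightarrow> nat \<Rightarrow> real) \<Rightarrow> (nat \<Rightarrow> real) \<Rightarrow> nat \<times> (nat \<Rightarrow> bool) \<Rightarrow> real" where
  "group_tilt n A b x = (\<Prod>j=1..n. tilt (A (fst x) j) (b j) (snd x j))"

text \<open>Given the label, the nodes are independent and each factor has mean at most 1; averaging
  over the label keeps the bound.\<close>

lemma nn_integral_group_tilt_le:
  assumes model: "hub_model nL n \<rho> A" and b: "\<And>j. j \<in> {1..n} \<Longrightarrow> 0 \<le> b j \<and> b j \<le> 1"
  shows "(\<integral>\<^sup>+x. ennreal (group_tilt n A b x) \<partial>measure_pmf (hub_group_pmf n \<rho> A)) \<le> 1"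
proof -
  note m = hub_modelD[OF model]
  have "(\<integral>\<^sup>+g. ennreal (group_tilt n A b (i, g)) \<partial>measure_pmf (Pi_pmf {1..n} False (\<lambda>j. bernoulli_pmf (A i j)))) \<le> 1"
    if i: "i \<in> set_pmf \<rho>" for i
  proof -
    have i': "i \<in> {0..nL}" using m(4) i .
    have "(\<integral>\<^sup>+g. ennreal (group_tilt n A b (i, g)) \<partial>measure_pmf (Pi_pmf {1..n} False (\<lambda>j. bernoulli_pmf (A i j))))
        = (\<integral>\<^sup>+g. (\<Prod>j=1..n. ennreal (tilt (A i j) (b j) (g j))) \<partial>measure_pmf (Pi_pmf {1..n} False (\<lambda>j. bernoulli_pmf (A i j))))"
      unfolding group_tilt_def fst_conv snd_conv
      by (intro nn_integral_cong prod_ennreal[symmetric] tilt_nonneg) (use m(1,2)[OF i'] b in auto)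
    also have "\<dots> = (\<Prod>j=1..n. \<integral>\<^sup>+x. ennreal (tilt (A i j) (b j) x) \<partial>measure_pmf (bernoulli_pmf (A i j)))"
      by (rule nn_integral_prod_Pi_pmf) simp
    also have "\<dots> \<le> (\<Prod>j=1..n. 1)"
      using m(1,2)[OF i'] b by (intro prod_mono_ennreal nn_integral_tilt_le) auto
    finally show ?thesis by simp
  qed
  then have "(\<integral>\<^sup>+i. (\<integral>\<^sup>+g. ennreal (group_tilt n A b (i, g)) \<partial>measure_pmf (Pi_pmf {1..n} False (\<lambda>j. bernoulli_pmf (A i j)))) \<partial>measure_pmf \<rho>)
      \<le> (\<integral>\<^sup>+i. 1 \<partial>measure_pmf \<rho>)"
    by (intro nn_integral_mono_AE AE_pmfI)
  then show ?thesis by (simp add: hub_group_pmf_def)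
qed

section \<open>The profile likelihood as a maximum over parameters\<close>

lemma A_hat_eq:
  "A_hat T G z i j = real (card {t\<in>{1..T}. z t = i \<and> G t j}) / real (card {t\<in>{1..T}. z t = i})"
  unfolding A_hat_def label_count_def of_bool_conj[symmetric] by (simp add: Int_def conj_commute)

text \<open>Group \<open>t\<close> belongs to its own class, so the value it shows at node
  \<open>j\<close> has positive frequency there. Hence every logarithm in \<open>log_lik\<close> can
  be undone by \<open>exp\<close>.\<close>

lemma bern_lik_A_hat_pos:
  assumes t: "t \<in> {1..T}"
  shows "0 < bern_lik (A_hat T G z (z t) j) (G t j)"
proof -
  let ?S = "{s\<in>{1..T}. z s = z t}" and ?K = "{s\<in>{1..T}. z s = z t \<and> G s j}"
  have S: "0 < card ?S" using t by (auto simp: card_gt_0_iff)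
  show "0 < bern_lik (A_hat T G z (z t) j) (G t j)"
  proof (cases "G t j")
    case True
    then have "0 < card ?K" using t by (auto simp: card_gt_0_iff)
    then show ?thesis using True S by (simp add: bern_lik_def A_hat_eq)
  next
    case False
    then have "?K \<subset> ?S" using t by auto
    then have "card ?K < card ?S" by (intro psubset_card_mono) auto
    then show ?thesis using False S by (simp add: bern_lik_def A_hat_eq)
  qed
qed

lemma log_lik_eq_ln_bern_lik:
  "log_lik T n G z = (\<Sum>t=1..T. \<Sum>j=1..n. ln (bern_lik (A_hat T G z (z t) j) (G t j)))"
  unfolding log_lik_def bern_lik_def by (intro sum.cong refl) auto

lemma exp_log_lik:
  "exp (log_lik T n G z) = (\<Prod>t=1..T. \<Prod>j=1..n. bern_lik (A_hat T G z (z t) j) (G t j))"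
  unfolding log_lik_eq_ln_bern_lik
  by (simp add: exp_sum bern_lik_A_hat_pos)

text \<open>With \<open>k\<close> ones among \<open>s\<close> observations and
  \<open>q = k / s\<close>, the ones contribute \<open>s * p\<close> and the zeros
  \<open>s * (1 - p)\<close>, except that an absent value contributes 0. This is why only an
  inequality holds.\<close>

lemma sum_bern_lik_ratio_le:
  assumes fin: "finite S" and p: "0 \<le> p" "p \<le> 1"
    and q: "q = real (card {t\<in>S. g t}) / real (card S)"
  shows "(\<Sum>t\<in>S. bern_lik p (g t) / bern_lik q (g t)) \<le> real (card S)"
proof (cases "S = {}")
  case False
  define s k where "s = real (card S)" and "k = real (card {t\<in>S. g t})"
  have s: "0 < s" using False fin by (simp add: s_def card_gt_0_iff)
  have k: "0 \<le> k" "k \<le> s" unfolding k_def s_def using fin by (auto intro: card_mono)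
  have "card S = card {t\<in>S. g t} + card {t\<in>S. \<not> g t}"
    using fin by (subst card_Un_disjoint[symmetric]) (auto intro: arg_cong[where f = card])
  then have k': "real (card {t\<in>S. \<not> g t}) = s - k" by (simp add: s_def k_def)
  have "(\<Sum>t\<in>S. bern_lik p (g t) / bern_lik q (g t))
      = (\<Sum>t\<in>S. if g t then p / q else (1 - p) / (1 - q))"
    by (intro sum.cong) (auto simp: bern_lik_def)
  also have "\<dots> = k * (p / q) + (s - k) * ((1 - p) / (1 - q))"
    using fin k' by (simp add: sum.If_cases Int_def k_def)
  also have "\<dots> \<le> s * p + s * (1 - p)"
  proof (intro add_mono)
    have q: "q = k / s" "1 - q = (s - k) / s" using s by (simp_all add: q k_def s_def field_simps)
    have le: "a * (c / (a / s)) \<le> s * c" if "0 \<le> c" for a c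
      using that s by (cases "a = 0") auto
    show "k * (p / q) \<le> s * p"
      unfolding q(1) by (rule le) (use p in simp)
    show "(s - k) * ((1 - p) / (1 - q)) \<le> s * (1 - p)"
      unfolding q(2) by (rule le) (use p in simp)
  qed
  finally show ?thesis by (simp add: s_def algebra_simps)
qed simp

text \<open>For fixed labels the empirical frequencies maximize the likelihood. In each column the
  ratios \<open>r\<close> sum to at most \<open>T\<close>, class by class, and
  \<open>r \<le> exp (r - 1)\<close> then bounds their product by 1. Working with ratios instead of
  logarithms admits entries of \<open>P\<close> equal to 0 or 1.\<close>

lemma likelihood_le_exp_log_lik:
  assumes P: "\<And>t j. t \<in> {1..T} \<Longrightarrow> j \<in> {1..n} \<Longrightarrow> 0 \<le> P (z t) j \<and> P (z t) j \<le> 1"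
  shows "(\<Prod>t=1..T. \<Prod>j=1..n. bern_lik (P (z t) j) (G t j)) \<le> exp (log_lik T n G z)"
proof -
  have "(\<Prod>t=1..T. bern_lik (P (z t) j) (G t j)) \<le> (\<Prod>t=1..T. bern_lik (A_hat T G z (z t) j) (G t j))"
    if j: "j \<in> {1..n}" for j
  proof -
    let ?r = "\<lambda>t. bern_lik (P (z t) j) (G t j) / bern_lik (A_hat T G z (z t) j) (G t j)"
    have r: "(\<Sum>t=1..T. ?r t) \<le> real T"
    proof -
      have "(\<Sum>t=1..T. ?r t) = (\<Sum>i\<in>z ` {1..T}. \<Sum>t\<in>{t\<in>{1..T}. z t = i}. ?r t)"
        by (rule sum.image_gen) simp
      also have "\<dots> \<le> (\<Sum>i\<in>z ` {1..T}. real (card {t\<in>{1..T}. z t = i}))"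
      proof (rule sum_mono)
        fix i assume "i \<in> z ` {1..T}"
        then have Pi: "0 \<le> P i j" "P i j \<le> 1" using P j by auto
        have "(\<Sum>t\<in>{t\<in>{1..T}. z t = i}. ?r t)
            = (\<Sum>t\<in>{t\<in>{1..T}. z t = i}. bern_lik (P i j) (G t j) / bern_lik (A_hat T G z i j) (G t j))"
          by (intro sum.cong) auto
        also have "\<dots> \<le> real (card {t\<in>{1..T}. z t = i})"
          using Pi by (intro sum_bern_lik_ratio_le) (auto simp: A_hat_eq conj_assoc)
        finally show "(\<Sum>t\<in>{t\<in>{1..T}. z t = i}. ?r t) \<le> real (card {t\<in>{1..T}. z t = i})" .
      qed
      also have "\<dots> = (\<Sum>i\<in>z ` {1..T}. \<Sum>t\<in>{t\<in>{1..T}. z t = i}. 1)" by simp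
      also have "\<dots> = (\<Sum>t=1..T. 1)"
        by (rule sum.image_gen[symmetric]) simp
      finally show ?thesis by simp
    qed
    have nonneg: "0 \<le> ?r t" if "t \<in> {1..T}" for t
      using P[OF that j] bern_lik_A_hat_pos[OF that, of G z j]
      by (intro divide_nonneg_pos bern_lik_nonneg) auto
    have "(\<Prod>t=1..T. ?r t) \<le> (\<Prod>t=1..T. exp (?r t - 1))"
      using nonneg exp_ge_add_one_self[of "?r t - 1" for t] by (intro prod_mono) simp
    also have "\<dots> = exp ((\<Sum>t=1..T. ?r t) - real T)"
      by (simp add: exp_sum[symmetric] sum_subtractf)
    also have "\<dots> \<le> 1" using r by simp
    finally have "(\<Prod>t=1..T. bern_lik (P (z t) j) (G t j)) / (\<Prod>t=1..T. bern_lik (A_hat T G z (z t) j) (G t j)) \<le> 1"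
      by (simp add: prod_dividef)
    moreover have "0 < (\<Prod>t=1..T. bern_lik (A_hat T G z (z t) j) (G t j))"
      by (intro prod_pos) (simp add: bern_lik_A_hat_pos)
    ultimately show ?thesis by (simp only: divide_le_eq_1_pos)
  qed
  then have "(\<Prod>j=1..n. \<Prod>t=1..T. bern_lik (P (z t) j) (G t j))
      \<le> (\<Prod>j=1..n. \<Prod>t=1..T. bern_lik (A_hat T G z (z t) j) (G t j))"
    using P by (intro prod_mono[of "{1..n}"] conjI prod_nonneg bern_lik_nonneg) auto
  then show ?thesis
    unfolding exp_log_lik by (simp only: prod.swap[of _ "{1..n}" "{1..T}"])
qed

section \<open>The squared distance that mislabeled groups pay\<close>

text \<open>By separation, at most one true row \<open>\<sigma> a\<close> is within squared distance
  \<open>D / 4\<close> of the fitted row \<open>B a\<close>. A mislabeled group whose true label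
  differs from \<open>\<sigma> (z t)\<close> pays \<open>D / 4\<close>. The others lie in a class
  \<open>a\<close> with \<open>\<sigma> a \<noteq> a\<close> and have true label
  \<open>\<sigma> a\<close>: at most \<open>c0\<close> of them in class 0 and at most
  \<open>c1\<close> in each hub class.\<close>

lemma mislabeled_signal:
  fixes A B :: "nat \<Rightarrow> nat \<Rightarrow> real"
  assumes sep: "\<And>i i'. i \<in> {0..nL} \<Longrightarrow> i' \<in> {0..nL} \<Longrightarrow> i \<noteq> i' \<Longrightarrow> D \<le> (\<Sum>j\<in>J. (A i j - A i' j)\<^sup>2)"
    and D: "0 < D" and I: "finite I"
    and zs: "\<And>t. t \<in> I \<Longrightarrow> zs t \<in> {0..nL}" and z: "\<And>t. t \<in> I \<Longrightarrow> z t \<in> {0..nL}"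
    and c0: "\<And>i. i \<in> {0..nL} \<Longrightarrow> real (card {t\<in>I. zs t = i}) \<le> c0"
    and c1: "\<And>i a. i \<in> {0..nL} \<Longrightarrow> a \<in> {1..nL} \<Longrightarrow> i \<noteq> a \<Longrightarrow> real (card {t\<in>I. zs t = i \<and> z t = a}) \<le> c1"
  shows "(real (card {t\<in>I. zs t \<noteq> z t}) - c0 - real nL * c1) * (D / 4)
    \<le> (\<Sum>t\<in>I. \<Sum>j\<in>J. (A (zs t) j - B (z t) j)\<^sup>2)"
proof -
  define F where "F i a = (\<Sum>j\<in>J. (A i j - B a j)\<^sup>2)" for i a
  \<comment> \<open>If no true row is close, every label pays \<open>D / 4\<close> against
    \<open>B a\<close>; the default 0 just keeps \<open>\<sigma> a\<close> a valid label.\<close>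
  define \<sigma> where "\<sigma> a = (if \<exists>i\<in>{0..nL}. F i a < D / 4 then SOME i. i \<in> {0..nL} \<and> F i a < D / 4 else 0)" for a
  have \<sigma>: "\<sigma> a \<in> {0..nL} \<and> F (\<sigma> a) a < D / 4" if "i \<in> {0..nL}" "F i a < D / 4" for i a
  proof -
    have ex: "\<exists>i. i \<in> {0..nL} \<and> F i a < D / 4" using that by blast
    have "\<sigma> a = (SOME i. i \<in> {0..nL} \<and> F i a < D / 4)"
      unfolding \<sigma>_def by (intro if_P) (use ex in blast)
    then show ?thesis using someI_ex[OF ex] by (simp only:)
  qed
  have \<sigma>_le: "\<sigma> a \<in> {0..nL}" for a
  proof (cases "\<exists>i\<in>{0..nL}. F i a < D / 4")
    case True then show ?thesis using \<sigma> by blast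
  next
    case False then show ?thesis unfolding \<sigma>_def if_not_P[OF False] by simp
  qed
  have F: "D / 4 \<le> F i a" if i: "i \<in> {0..nL}" and ne: "i \<noteq> \<sigma> a" for i a
  proof (rule ccontr)
    assume "\<not> D / 4 \<le> F i a"
    then have lt: "F i a < D / 4" by simp
    have "D \<le> (\<Sum>j\<in>J. (A i j - A (\<sigma> a) j)\<^sup>2)"
      using sep[OF i \<sigma>_le ne] .
    \<comment> \<open>Two close rows would be at squared distance below \<open>D\<close>, through
      \<open>(x - y)\<^sup>2 \<le> 2 * x\<^sup>2 + 2 * y\<^sup>2\<close>.\<close>
    also have "\<dots> \<le> (\<Sum>j\<in>J. 2 * (A i j - B a j)\<^sup>2 + 2 * (A (\<sigma> a) j - B a j)\<^sup>2)"
    proof (rule sum_mono)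
      fix j
      have "0 \<le> ((A i j - B a j) + (A (\<sigma> a) j - B a j))\<^sup>2" by simp
      then show "(A i j - A (\<sigma> a) j)\<^sup>2 \<le> 2 * (A i j - B a j)\<^sup>2 + 2 * (A (\<sigma> a) j - B a j)\<^sup>2"
        by (simp add: power2_eq_square algebra_simps)
    qed
    also have "\<dots> = 2 * F i a + 2 * F (\<sigma> a) a"
      by (simp add: F_def sum.distrib sum_distrib_left)
    also have "\<dots> < D" using lt \<sigma>[OF i lt] by simp
    finally show False by simp
  qed
  let ?P = "{t\<in>I. zs t \<noteq> \<sigma> (z t)}" and ?Q = "\<lambda>a. {t\<in>I. zs t = \<sigma> a \<and> z t = a \<and> \<sigma> a \<noteq> a}"
  have "{t\<in>I. zs t \<noteq> z t} \<subseteq> ?P \<union> (?Q 0 \<union> (\<Union>a\<in>{1..nL}. ?Q a))"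
  proof
    fix t assume t: "t \<in> {t\<in>I. zs t \<noteq> z t}"
    show "t \<in> ?P \<union> (?Q 0 \<union> (\<Union>a\<in>{1..nL}. ?Q a))"
    proof (cases "zs t = \<sigma> (z t)")
      case True
      then have Q: "t \<in> ?Q (z t)" using t by simp
      show ?thesis
      proof (cases "z t = 0")
        case True
        with Q have "t \<in> ?Q 0" by (simp only:)
        then show ?thesis by blast
      next
        case False
        then have "z t \<in> {1..nL}" using z t by simp
        then show ?thesis using Q by blast
      qed
    qed (use t in simp)
  qed
  then have "card {t\<in>I. zs t \<noteq> z t} \<le> card (?P \<union> (?Q 0 \<union> (\<Union>a\<in>{1..nL}. ?Q a)))"
    using I by (intro card_mono) auto
  also have "\<dots> \<le> card ?P + (card (?Q 0) + (\<Sum>a\<in>{1..nL}. card (?Q a)))"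
    by (intro order_trans[OF card_Un_le] add_left_mono card_UN_le finite_atLeastAtMost)
  finally have "real (card {t\<in>I. zs t \<noteq> z t}) \<le> real (card ?P) + (real (card (?Q 0)) + (\<Sum>a\<in>{1..nL}. real (card (?Q a))))"
    by (simp flip: of_nat_sum of_nat_add)
  also have "real (card (?Q 0)) \<le> c0"
  proof -
    have "card (?Q 0) \<le> card {t\<in>I. zs t = \<sigma> 0}" using I by (intro card_mono) auto
    then show ?thesis using c0[OF \<sigma>_le[of 0]] by linarith
  qed
  also have "(\<Sum>a\<in>{1..nL}. real (card (?Q a))) \<le> real (card {1..nL}) * c1"
  proof (rule sum_bounded_above)
    fix a assume a: "a \<in> {1..nL}"
    \<comment> \<open>When \<open>\<sigma> a = a\<close> the set is empty, and
      \<open>0 \<le> c1\<close> is what is needed; the admissible pair \<open>(0, a)\<close>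
      supplies it.\<close>
    have "0 \<le> real (card {t\<in>I. zs t = 0 \<and> z t = a})" by simp
    also have "\<dots> \<le> c1" using a by (intro c1) auto
    finally have "0 \<le> c1" .
    then show "real (card (?Q a)) \<le> c1"
      using c1[OF \<sigma>_le a] by (cases "\<sigma> a = a") auto
  qed
  finally have "real (card {t\<in>I. zs t \<noteq> z t}) - c0 - real nL * c1 \<le> real (card ?P)" by simp
  then have "(real (card {t\<in>I. zs t \<noteq> z t}) - c0 - real nL * c1) * (D / 4) \<le> real (card ?P) * (D / 4)"
    using D by (intro mult_right_mono) auto
  also have "\<dots> \<le> (\<Sum>t\<in>?P. F (zs t) (z t))"
    by (rule sum_bounded_below) (use F zs in auto)
  also have "\<dots> \<le> (\<Sum>t\<in>I. F (zs t) (z t))"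
    using I by (intro sum_mono2) (auto simp: F_def intro: sum_nonneg)
  finally show ?thesis by (simp add: F_def)
qed

section \<open>The law of the sample and the likelihood ratio at the maximizer\<close>

lemma sqrt_prod: "sqrt (\<Prod>x\<in>S. f x) = (\<Prod>x\<in>S. sqrt (f x))"
  by (induction S rule: infinite_finite_induct) (auto simp: real_sqrt_mult)

lemma map_fst_hub_group_pmf: "map_pmf fst (hub_group_pmf n \<rho> A) = \<rho>"
  by (simp add: hub_group_pmf_def map_bind_pmf map_pmf_comp bind_return_pmf')

lemma prob_hub_group_label: "measure_pmf.prob (hub_group_pmf n \<rho> A) {x. fst x = i} = pmf \<rho> i"
proof -
  have "pmf (map_pmf fst (hub_group_pmf n \<rho> A)) i = measure_pmf.prob (hub_group_pmf n \<rho> A) {x. fst x = i}"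
    by (simp add: pmf_map vimage_def)
  then show ?thesis by (simp add: map_fst_hub_group_pmf)
qed

text \<open>Feasibility allows a group in hub class \<open>a\<close> only if it contains node
  \<open>a\<close>, so this event controls how many groups of true label \<open>i\<close> can be
  placed there.\<close>

lemma prob_hub_group_label_node:
  assumes a: "a \<in> {1..n}" and A: "0 \<le> A i a" "A i a \<le> 1"
  shows "measure_pmf.prob (hub_group_pmf n \<rho> A) {x. fst x = i \<and> snd x a} = pmf \<rho> i * A i a"
proof -
  let ?X = "{x :: nat \<times> (nat \<Rightarrow> bool). fst x = i \<and> snd x a}"
  let ?N = "\<lambda>i. Pi_pmf {1..n} False (\<lambda>j. bernoulli_pmf (A i j))"
  have "emeasure (measure_pmf (?N i)) {g. g a} = emeasure (measure_pmf (map_pmf (\<lambda>g. g a) (?N i))) {True}"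
    by (simp add: vimage_def)
  also have "map_pmf (\<lambda>g. g a) (?N i) = bernoulli_pmf (A i a)"
    using a by (simp add: Pi_pmf_component)
  also have "emeasure (measure_pmf (bernoulli_pmf (A i a))) {True} = ennreal (A i a)"
    using A by (simp add: emeasure_pmf_single)
  finally have N: "emeasure (measure_pmf (?N i)) {g. g a} = ennreal (A i a)" .
  have "emeasure (measure_pmf (hub_group_pmf n \<rho> A)) ?X
      = (\<integral>\<^sup>+i'. emeasure (measure_pmf (?N i')) (Pair i' -` ?X) \<partial>measure_pmf \<rho>)"
    by (simp add: hub_group_pmf_def)
  also have "\<dots> = (\<integral>\<^sup>+i'. ennreal (A i a) * indicator {i} i' \<partial>measure_pmf \<rho>)"
    using N by (intro nn_integral_cong) (auto simp: vimage_def indicator_def)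
  also have "\<dots> = ennreal (A i a) * ennreal (pmf \<rho> i)"
    by (simp add: nn_integral_cmult emeasure_pmf_single)
  also have "\<dots> = ennreal (pmf \<rho> i * A i a)"
    using A by (simp add: ennreal_mult'[symmetric] mult.commute)
  finally show ?thesis
    using A by (simp add: measure_pmf.emeasure_eq_measure)
qed

text \<open>On the support, almost sure facts become pointwise ones: the true parameters give every
  observation positive likelihood, so it is legitimate to divide by it.\<close>

lemma hub_sample_support:
  assumes model: "hub_model nL n \<rho> A" and \<omega>: "\<omega> \<in> set_pmf (hub_sample_pmf T n \<rho> A)" and t: "t \<in> {1..T}"
  shows "true_labels \<omega> t \<in> {0..nL}"
    and "j \<in> {1..n} \<Longrightarrow> 0 < bern_lik (A (true_labels \<omega> t) j) (observed_groups \<omega> t j)"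
proof -
  note m = hub_modelD[OF model]
  have "\<omega> t \<in> set_pmf (hub_group_pmf n \<rho> A)"
    using \<omega> t by (auto simp: hub_sample_pmf_def set_Pi_pmf PiE_dflt_def)
  then obtain i g where i: "i \<in> set_pmf \<rho>" and \<omega>t: "\<omega> t = (i, g)"
    and g: "g \<in> set_pmf (Pi_pmf {1..n} False (\<lambda>j. bernoulli_pmf (A i j)))"
    by (auto simp: hub_group_pmf_def)
  show "true_labels \<omega> t \<in> {0..nL}" using m(4)[OF i] by (simp add: true_labels_def \<omega>t)
  assume j: "j \<in> {1..n}"
  then have "g j \<in> set_pmf (bernoulli_pmf (A i j))"
    using g by (auto simp: set_Pi_pmf PiE_dflt_def)
  then have "0 < pmf (bernoulli_pmf (A i j)) (g j)" by (simp add: pmf_positive)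
  then show "0 < bern_lik (A (true_labels \<omega> t) j) (observed_groups \<omega> t j)"
    using m(1,2)[OF m(4)[OF i] j]
    by (cases "g j") (auto simp: true_labels_def observed_groups_def \<omega>t bern_lik_def)
qed

text \<open>As \<open>A i i = 1\<close>, a hub always belongs to its own group. The truth is
  therefore a competitor in the maximization.\<close>

lemma feasible_true_labels:
  assumes model: "hub_model nL n \<rho> A" and \<omega>: "\<omega> \<in> set_pmf (hub_sample_pmf T n \<rho> A)"
  shows "feasible T nL (observed_groups \<omega>) (true_labels \<omega>)"
  unfolding feasible_def
proof
  fix t assume t: "t \<in> {1..T}"
  let ?i = "true_labels \<omega> t"
  note m = hub_modelD[OF model]
  have i: "?i \<in> {0..nL}" using hub_sample_support(1)[OF model \<omega> t] .
  have "observed_groups \<omega> t ?i" if "?i \<noteq> 0"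
  proof -
    have "?i \<in> {1..nL}" using that i by auto
    moreover from this have "?i \<in> {1..n}" using m(5) by auto
    ultimately have "0 < bern_lik 1 (observed_groups \<omega> t ?i)"
      using hub_sample_support(2)[OF model \<omega> t, of ?i] m(3)[of ?i] by simp
    then show ?thesis by (simp add: bern_lik_def split: if_splits)
  qed
  then show "?i \<in> {0..nL} \<and> (?i = 0 \<or> observed_groups \<omega> t ?i)" using i by blast
qed

text \<open>The true likelihood is at most the profile likelihood of the true labels, hence at most
  that of the maximizer \<open>z\<close>. So the likelihood ratio of the fit to the truth is at
  least 1, as is its square root, and only the exponential factors of the tilts remain as a lower
  bound.\<close>

lemma exp_signal_le_prod_group_tilt:
  assumes model: "hub_model nL n \<rho> A" and \<omega>: "\<omega> \<in> set_pmf (hub_sample_pmf T n \<rho> A)"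
    and mle: "profile_mle T nL n (observed_groups \<omega>) z"
  shows "exp ((\<Sum>t=1..T. \<Sum>j=1..n. (A (true_labels \<omega> t) j - A_hat T (observed_groups \<omega>) z (z t) j)\<^sup>2) / 4)
    \<le> (\<Prod>t=1..T. group_tilt n A (A_hat T (observed_groups \<omega>) z (z t)) (\<omega> t))"
proof -
  note m = hub_modelD[OF model] and supp = hub_sample_support[OF model \<omega>]
  let ?G = "observed_groups \<omega>" and ?z = "true_labels \<omega>"
  let ?B = "\<lambda>t j. A_hat T ?G z (z t) j"
  define LA where "LA = (\<Prod>t=1..T. \<Prod>j=1..n. bern_lik (A (?z t) j) (?G t j))"
  have pos: "0 < LA" unfolding LA_def by (intro prod_pos supp)
  have "LA \<le> exp (log_lik T n ?G ?z)"
    unfolding LA_def using m(1,2) supp(1) by (intro likelihood_le_exp_log_lik) blast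
  also have "\<dots> \<le> exp (log_lik T n ?G z)"
    using mle feasible_true_labels[OF model \<omega>] unfolding profile_mle_def is_arg_max_linorder by simp
  also have "\<dots> = (\<Prod>t=1..T. \<Prod>j=1..n. bern_lik (?B t j) (?G t j))" by (rule exp_log_lik)
  finally have "1 \<le> (\<Prod>t=1..T. \<Prod>j=1..n. bern_lik (?B t j) (?G t j)) / LA"
    using pos by simp
  also have "\<dots> = (\<Prod>t=1..T. \<Prod>j=1..n. bern_lik (?B t j) (?G t j) / bern_lik (A (?z t) j) (?G t j))"
    unfolding LA_def by (simp add: prod_dividef)
  finally have "1 \<le> (\<Prod>t=1..T. \<Prod>j=1..n. sqrt (bern_lik (?B t j) (?G t j) / bern_lik (A (?z t) j) (?G t j)))"
    unfolding sqrt_prod[symmetric] by simp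
  then have "1 * exp ((\<Sum>t=1..T. \<Sum>j=1..n. (A (?z t) j - ?B t j)\<^sup>2) / 4)
      \<le> (\<Prod>t=1..T. \<Prod>j=1..n. sqrt (bern_lik (?B t j) (?G t j) / bern_lik (A (?z t) j) (?G t j)))
        * exp ((\<Sum>t=1..T. \<Sum>j=1..n. (A (?z t) j - ?B t j)\<^sup>2) / 4)"
    by (intro mult_right_mono) auto
  also have "exp ((\<Sum>t=1..T. \<Sum>j=1..n. (A (?z t) j - ?B t j)\<^sup>2) / 4)
      = (\<Prod>t=1..T. \<Prod>j=1..n. exp ((A (?z t) j - ?B t j)\<^sup>2 / 4))"
    by (simp add: exp_sum sum_divide_distrib)
  also have "(\<Prod>t=1..T. \<Prod>j=1..n. sqrt (bern_lik (?B t j) (?G t j) / bern_lik (A (?z t) j) (?G t j)))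
        * (\<Prod>t=1..T. \<Prod>j=1..n. exp ((A (?z t) j - ?B t j)\<^sup>2 / 4))
      = (\<Prod>t=1..T. group_tilt n A (?B t) (\<omega> t))"
    by (simp add: group_tilt_def tilt_def prod.distrib true_labels_def observed_groups_def)
  finally show ?thesis by (simp add: exp_sum sum_divide_distrib)
qed

section \<open>Union bound over assignments and gridded parameters\<close>

text \<open>A finite set, independent of the data, that contains every value of
  \<open>A_hat\<close>. The denominator 0 stands for an empty class, whose frequency is 0;
  intersecting with the unit interval makes every grid point a valid parameter.\<close>

definition frac_grid :: "nat \<Rightarrow> real set" where
  "frac_grid T = (\<lambda>(k, t). real k / real t) ` ({0..T} \<times> {0..T}) \<inter> {0..1}"

lemma finite_frac_grid: "finite (frac_grid T)"
  by (simp add: frac_grid_def)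

lemma card_frac_grid: "card (frac_grid T) \<le> (T + 1)\<^sup>2"
proof -
  have "card (frac_grid T) \<le> card ((\<lambda>(k, t). real k / real t) ` ({0..T} \<times> {0..T}))"
    unfolding frac_grid_def by (intro card_mono) auto
  also have "\<dots> \<le> card ({0..T} \<times> {0..T})" by (intro card_image_le) simp
  finally show ?thesis by (simp add: power2_eq_square)
qed

lemma A_hat_in_frac_grid: "A_hat T G z i j \<in> frac_grid T"
proof -
  let ?K = "{t\<in>{1..T}. z t = i \<and> G t j}" and ?S = "{t\<in>{1..T}. z t = i}"
  have le: "card ?K \<le> card ?S" by (intro card_mono) auto
  have T: "card ?S \<le> T" using card_mono[of "{1..T}" ?S] by fastforce
  have "real (card ?K) / real (card ?S) \<in> (\<lambda>(k, t). real k / real t) ` ({0..T} \<times> {0..T})"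
    using le T by (intro image_eqI[where x = "(card ?K, card ?S)"]) auto
  moreover have "real (card ?K) / real (card ?S) \<in> {0..1}"
    using le by (auto simp: divide_le_eq_1)
  ultimately show ?thesis by (simp add: A_hat_eq frac_grid_def)
qed

text \<open>Three bad events are bounded: \<open>B0\<close>, some label is too frequent;
  \<open>B1\<close>, some wrong leader occurs too often in the groups of one label;
  \<open>B2\<close>, some fixed pair of assignment and gridded parameters has a large product of
  tilts. Outside them \<open>mislabeled_signal\<close> leaves fewer than \<open>m\<close> groups
  beyond the two count terms. The 16 is a 4 from the distance paid per group times a 4 from the
  exponent of \<open>tilt\<close>.\<close>

lemma prob_mislabeled_le:
  assumes model: "hub_model nL n \<rho> A" and D: "0 < D"
    and sep: "\<And>i i'. i \<in> {0..nL} \<Longrightarrow> i' \<in> {0..nL} \<Longrightarrow> i \<noteq> i' \<Longrightarrow> D \<le> (\<Sum>j=1..n. (A i j - A i' j)\<^sup>2)"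
    and q0: "\<And>i. i \<in> {0..nL} \<Longrightarrow> pmf \<rho> i \<le> q0"
    and q1: "\<And>i a. i \<in> {0..nL} \<Longrightarrow> a \<in> {1..nL} \<Longrightarrow> i \<noteq> a \<Longrightarrow> pmf \<rho> i * A i a \<le> q1"
    and mle: "\<And>G. profile_mle T nL n G (z_hat G)"
  shows "measure_pmf.prob (hub_sample_pmf T n \<rho> A)
      {\<omega>. m + 3 * q0 * T + nL * (3 * q1 * T)
        < real (num_mislabeled T (true_labels \<omega>) (z_hat (observed_groups \<omega>)))}
    \<le> real (nL + 1) * exp (- (q0 * T)) + real ((nL + 1) * nL) * exp (- (q1 * T))
      + real ((nL + 1) ^ T * (((T + 1)\<^sup>2) ^ n) ^ (nL + 1)) * exp (- (m * D / 16))"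
    (is "measure_pmf.prob ?P ?E \<le> _")
proof -
  note md = hub_modelD[OF model]
  define B0 where "B0 = (\<Union>i\<in>{0..nL}. {\<omega>. 3 * q0 * card {1..T} \<le> card {t\<in>{1..T}. \<omega> t \<in> {x :: nat \<times> (nat \<Rightarrow> bool). fst x = i}}})"
  define Ia where "Ia = {(i, a). i \<in> {0..nL} \<and> a \<in> {1..nL} \<and> i \<noteq> a}"
  define B1 where "B1 = (\<Union>(i, a)\<in>Ia. {\<omega>. 3 * q1 * card {1..T} \<le> card {t\<in>{1..T}. \<omega> t \<in> {x. fst x = i \<and> snd x a}}})"
  \<comment> \<open>Extensional functions make both families finite. \<open>BB\<close> has
    \<open>nL + 1\<close> rows because the hubless class is fitted as well.\<close>
  define Z where "Z = PiE {1..T} (\<lambda>_. {0..nL})"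
  define BB where "BB = PiE {0..nL} (\<lambda>_. PiE {1..n} (\<lambda>_. frac_grid T))"
  define B2 where "B2 = (\<Union>(z, B)\<in>Z \<times> BB. {\<omega>. exp (m * D / 16) \<le> (\<Prod>t\<in>{1..T}. group_tilt n A (B (z t)) (\<omega> t))})"
  have fin: "finite Ia" "card Ia \<le> (nL + 1) * nL"
  proof -
    have sub: "Ia \<subseteq> {0..nL} \<times> {1..nL}" by (auto simp: Ia_def)
    then show "finite Ia" by (rule finite_subset) simp
    show "card Ia \<le> (nL + 1) * nL" using card_mono[OF _ sub] by simp
  qed
  have finZ: "finite Z" "finite BB"
    unfolding Z_def BB_def by (intro finite_PiE finite_frac_grid; simp)+
  have "card (Z \<times> BB) = (nL + 1) ^ T * (card (frac_grid T) ^ n) ^ (nL + 1)"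
    by (simp add: card_cartesian_product Z_def BB_def card_PiE)
  then have cardZ: "card (Z \<times> BB) \<le> (nL + 1) ^ T * (((T + 1)\<^sup>2) ^ n) ^ (nL + 1)"
    by (simp only: mult_le_mono2 power_mono card_frac_grid zero_le)
  have p0: "measure_pmf.prob ?P B0 \<le> real (card {0..nL}) * exp (- (q0 * T))"
    unfolding B0_def
  proof (rule prob_UN_le)
    fix i assume i: "i \<in> {0..nL}"
    show "measure_pmf.prob ?P {\<omega>. 3 * q0 * card {1..T} \<le> card {t\<in>{1..T}. \<omega> t \<in> {x. fst x = i}}} \<le> exp (- (q0 * T))"
      unfolding hub_sample_pmf_def
      by (rule order_trans[OF Pi_pmf_count_upper_tail]) (use q0[OF i] in \<open>auto simp: prob_hub_group_label\<close>)
  qed simp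
  have p1: "measure_pmf.prob ?P B1 \<le> real (card Ia) * exp (- (q1 * T))"
    unfolding B1_def
  proof (rule prob_UN_le)
    fix ia assume ia: "ia \<in> Ia"
    obtain i a where eq: "ia = (i, a)" and i: "i \<in> {0..nL}" and a: "a \<in> {1..nL}" and ne: "i \<noteq> a"
      using ia by (auto simp: Ia_def)
    have an: "a \<in> {1..n}" using a md(5) by auto
    have le: "measure_pmf.prob (hub_group_pmf n \<rho> A) {x. fst x = i \<and> snd x a} \<le> q1"
      using q1[OF i a ne] md(1,2)[OF i an] by (simp add: prob_hub_group_label_node[OF an])
    show "measure_pmf.prob ?P (case ia of (i, a) \<Rightarrow> {\<omega>. 3 * q1 * card {1..T} \<le> card {t\<in>{1..T}. \<omega> t \<in> {x. fst x = i \<and> snd x a}}}) \<le> exp (- (q1 * T))"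
      unfolding hub_sample_pmf_def eq prod.case
      by (rule order_trans[OF Pi_pmf_count_upper_tail[OF _ le]]) auto
  qed (rule fin)
  have p2: "measure_pmf.prob ?P B2 \<le> real (card (Z \<times> BB)) * exp (- (m * D / 16))"
    unfolding B2_def
  proof (rule prob_UN_le)
    fix zB assume zB: "zB \<in> Z \<times> BB"
    obtain z B where eq: "zB = (z, B)" and z: "z \<in> Z" and B: "B \<in> BB"
      using zB by auto
    have Bt: "0 \<le> B (z t) j \<and> B (z t) j \<le> 1" if "t \<in> {1..T}" "j \<in> {1..n}" for t j
    proof -
      have "z t \<in> {0..nL}" using z that by (auto simp: Z_def)
      then have "B (z t) j \<in> frac_grid T" using B that(2) unfolding BB_def by (blast dest: PiE_mem)
      then show ?thesis by (simp add: frac_grid_def)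
    qed
    \<comment> \<open>Here \<open>z\<close> and \<open>B\<close> do not depend on the data, so the
      tilts of the groups are independent with means at most 1.\<close>
    have "measure_pmf.prob ?P {\<omega>. exp (m * D / 16) \<le> (\<Prod>t\<in>{1..T}. group_tilt n A (B (z t)) (\<omega> t))}
        \<le> 1 ^ card {1..T} / exp (m * D / 16)"
      unfolding hub_sample_pmf_def
    proof (rule Pi_pmf_prob_prod_ge)
      fix t x assume t: "t \<in> {1..T}"
      show "(\<integral>\<^sup>+x. ennreal (group_tilt n A (B (z t)) x) \<partial>measure_pmf (hub_group_pmf n \<rho> A)) \<le> ennreal 1"
        using nn_integral_group_tilt_le[OF model Bt[OF t]] by simp
      assume "x \<in> set_pmf (hub_group_pmf n \<rho> A)"
      then have "fst x \<in> {0..nL}" using md(4) by (auto simp: hub_group_pmf_def)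
      then show "0 \<le> group_tilt n A (B (z t)) x"
        using md(1,2) Bt[OF t] unfolding group_tilt_def by (intro prod_nonneg tilt_nonneg) auto
    qed auto
    then show "measure_pmf.prob ?P (case zB of (z, B) \<Rightarrow> {\<omega>. exp (m * D / 16) \<le> (\<Prod>t\<in>{1..T}. group_tilt n A (B (z t)) (\<omega> t))})
        \<le> exp (- (m * D / 16))"
      by (simp add: eq exp_minus inverse_eq_divide)
  qed (use finZ in simp)
  have "?E \<inter> set_pmf ?P \<subseteq> B0 \<union> B1 \<union> B2"
  proof
    fix \<omega> assume "\<omega> \<in> ?E \<inter> set_pmf ?P"
    then have E: "m + 3 * q0 * T + nL * (3 * q1 * T) < real (num_mislabeled T (true_labels \<omega>) (z_hat (observed_groups \<omega>)))"
      and \<omega>: "\<omega> \<in> set_pmf ?P" by auto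
    let ?G = "observed_groups \<omega>" and ?zs = "true_labels \<omega>"
    let ?z = "z_hat ?G"
    have feas: "?z t \<in> {0..nL}" "?z t = 0 \<or> ?G t (?z t)" if "t \<in> {1..T}" for t
      using mle[of ?G] that by (auto simp: profile_mle_def is_arg_max_def feasible_def)
    show "\<omega> \<in> B0 \<union> B1 \<union> B2"
    proof (rule ccontr)
      assume n: "\<omega> \<notin> B0 \<union> B1 \<union> B2"
      have c0: "real (card {t\<in>{1..T}. ?zs t = i}) \<le> 3 * q0 * T" if "i \<in> {0..nL}" for i
        using n that by (force simp: B0_def true_labels_def not_le)
      have c1: "real (card {t\<in>{1..T}. ?zs t = i \<and> ?z t = a}) \<le> 3 * q1 * T"
        if i: "i \<in> {0..nL}" and a: "a \<in> {1..nL}" and ne: "i \<noteq> a" for i a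
      proof -
        have ia: "(i, a) \<in> Ia" using i a ne by (simp add: Ia_def)
        \<comment> \<open>Since \<open>a\<close> is not 0, feasibility forces node \<open>a\<close>
          to be present.\<close>
        have "card {t\<in>{1..T}. ?zs t = i \<and> ?z t = a} \<le> card {t\<in>{1..T}. \<omega> t \<in> {x. fst x = i \<and> snd x a}}"
          using feas(2) a by (intro card_mono) (force simp: true_labels_def observed_groups_def)+
        moreover have "real (card {t\<in>{1..T}. \<omega> t \<in> {x. fst x = i \<and> snd x a}}) \<le> 3 * q1 * T"
          using n ia by (force simp: B1_def not_le)
        ultimately show ?thesis by linarith
      qed
      let ?S = "\<Sum>t=1..T. \<Sum>j=1..n. (A (?zs t) j - A_hat T ?G ?z (?z t) j)\<^sup>2"
      have "m * (D / 4) \<le> (real (card {t\<in>{1..T}. ?zs t \<noteq> ?z t}) - 3 * q0 * T - real nL * (3 * q1 * T)) * (D / 4)"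
        using E D by (intro mult_right_mono) (auto simp: num_mislabeled_def)
      also have "\<dots> \<le> ?S"
        by (rule mislabeled_signal[OF sep D _ _ _ c0 c1])
          (use hub_sample_support(1)[OF model \<omega>] feas in auto)
      finally have "m * D / 16 \<le> ?S / 4" by linarith
      then have "exp (m * D / 16) \<le> exp (?S / 4)" by simp
      also have "\<dots> \<le> (\<Prod>t=1..T. group_tilt n A (A_hat T ?G ?z (?z t)) (\<omega> t))"
        by (rule exp_signal_le_prod_group_tilt[OF model \<omega> mle])
      \<comment> \<open>The estimate is restricted to the index sets so that it becomes a member of
        \<open>Z\<close> and \<open>BB\<close>; the product reads no other values.\<close>
      also have "\<dots> = (\<Prod>t=1..T. group_tilt n A
          ((\<lambda>i\<in>{0..nL}. \<lambda>j\<in>{1..n}. A_hat T ?G ?z i j) ((\<lambda>t\<in>{1..T}. ?z t) t)) (\<omega> t))"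
        using feas(1) by (intro prod.cong refl) (auto simp: group_tilt_def intro!: prod.cong)
      finally have "exp (m * D / 16) \<le> \<dots>" .
      moreover have "(\<lambda>t\<in>{1..T}. ?z t) \<in> Z" using feas(1) by (simp add: Z_def restrict_PiE_iff)
      moreover have "(\<lambda>i\<in>{0..nL}. \<lambda>j\<in>{1..n}. A_hat T ?G ?z i j) \<in> BB"
        by (simp add: BB_def restrict_PiE_iff A_hat_in_frac_grid)
      ultimately have "\<omega> \<in> B2" unfolding B2_def by blast
      then show False using n by blast
    qed
  qed
  then have "measure_pmf.prob ?P (?E \<inter> set_pmf ?P) \<le> measure_pmf.prob ?P (B0 \<union> B1 \<union> B2)"
    by (intro measure_pmf.finite_measure_mono) auto
  also have "\<dots> \<le> measure_pmf.prob ?P B0 + measure_pmf.prob ?P B1 + measure_pmf.prob ?P B2"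
    using measure_Un_le[of B0 "measure_pmf ?P" B1] measure_Un_le[of "B0 \<union> B1" "measure_pmf ?P" B2] by simp
  also have "\<dots> \<le> real (card {0..nL}) * exp (- (q0 * T)) + real (card Ia) * exp (- (q1 * T))
      + real (card (Z \<times> BB)) * exp (- (m * D / 16))"
    by (intro add_mono p0 p1 p2)
  also have "\<dots> \<le> real (nL + 1) * exp (- (q0 * T)) + real ((nL + 1) * nL) * exp (- (q1 * T))
      + real ((nL + 1) ^ T * (((T + 1)\<^sup>2) ^ n) ^ (nL + 1)) * exp (- (m * D / 16))"
    by (intro add_mono mult_right_mono of_nat_mono fin cardZ) auto
  finally show ?thesis unfolding measure_Int_set_pmf .
qed

section \<open>Separation of the rows and size of the union bound\<close>

text \<open>Of two different labels at least one is a leader, and its set \<open>V\<close> alone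
  contributes \<open>d\<^sup>2\<close> for each of at least \<open>s\<close> nodes. If the first
  label is 0, the square is read with the roles exchanged.\<close>

lemma row_separation:
  fixes A :: "nat \<Rightarrow> nat \<Rightarrow> real"
  assumes d: "0 < d"
    and sep: "\<And>i. i \<in> {1..nL} \<Longrightarrow> \<exists>V\<subseteq>{1..n}. s \<le> real (card V) \<and>
      (\<forall>j\<in>V. \<forall>i'\<in>{0..nL}. i' \<noteq> i \<longrightarrow> A i j - A i' j \<ge> d)"
    and i: "i \<in> {0..nL}" "i' \<in> {0..nL}" "i \<noteq> i'"
  shows "d\<^sup>2 * s \<le> (\<Sum>j=1..n. (A i j - A i' j)\<^sup>2)"
proof -
  have *: "d\<^sup>2 * s \<le> (\<Sum>j=1..n. (A i j - A i' j)\<^sup>2)"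
    if i: "i \<in> {1..nL}" "i' \<in> {0..nL}" "i \<noteq> i'" for i i'
  proof -
    obtain V where V: "V \<subseteq> {1..n}" "s \<le> real (card V)"
      and "\<forall>j\<in>V. \<forall>i'\<in>{0..nL}. i' \<noteq> i \<longrightarrow> A i j - A i' j \<ge> d"
      using sep[OF i(1)] by blast
    then have dV: "d \<le> A i j - A i' j" if "j \<in> V" for j
      using i that by metis
    have "d\<^sup>2 * s \<le> real (card V) * d\<^sup>2"
      using mult_right_mono[OF V(2), of "d\<^sup>2"] by (simp add: mult.commute)
    also have "\<dots> \<le> (\<Sum>j\<in>V. (A i j - A i' j)\<^sup>2)"
    proof (rule sum_bounded_below)
      fix j assume "j \<in> V"
      then show "d\<^sup>2 \<le> (A i j - A i' j)\<^sup>2" using dV d by (intro power_mono) simp_all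
    qed
    also have "\<dots> \<le> (\<Sum>j=1..n. (A i j - A i' j)\<^sup>2)"
      using V(1) by (intro sum_mono2) auto
    finally show ?thesis .
  qed
  show ?thesis
  proof (cases "i = 0")
    case True
    then have "d\<^sup>2 * s \<le> (\<Sum>j=1..n. (A i' j - A i j)\<^sup>2)" using i by (intro *) auto
    then show ?thesis by (simp only: power2_commute[of "A i j" "A i' j" for j])
  next
    case False
    then show ?thesis using i by (intro *) auto
  qed
qed

lemma ln_Suc_le:
  assumes "2 \<le> m"
  shows "ln (real m + 1) \<le> 2 * ln (real m)"
proof -
  have "real m + 1 \<le> real m * 2" using assms by simp
  also have "\<dots> \<le> real m * real m" using assms by (intro mult_left_mono) simp_all
  finally have "real m + 1 \<le> real m ^ 2" by (simp only: power2_eq_square)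
  then have "ln (real m + 1) \<le> ln (real m ^ 2)"
    by (intro ln_mono) auto
  then show ?thesis using assms by (simp add: ln_realpow)
qed

text \<open>The logarithm of the number of assignments is of order \<open>T * ln nL\<close>, that of
  the number of gridded parameters of order \<open>nL * n * ln T\<close>. The rates
  \<open>r3\<close> and \<open>r2\<close>, respectively, make each a small fraction of
  \<open>\<epsilon> * T * D\<close>. From \<open>3 \<le> nL\<close> comes
  \<open>1 \<le> ln nL\<close>, which yields the remaining \<open>exp (- T)\<close>.\<close>

lemma union_bound_le_exp:
  fixes nL n T :: nat and d v \<epsilon> :: real
  assumes nL: "3 \<le> nL" and n: "0 < n" and T: "2 \<le> T"
    and d: "0 < d" "d \<le> 1" and v: "0 < v" "v \<le> 1" and \<epsilon>: "0 < \<epsilon>"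
    and r2: "real nL ^ 5 * ln (real T) / (d\<^sup>2 * v * real T) \<le> \<epsilon> / 640"
    and r3: "real nL ^ 8 * ln (real nL) / (d ^ 4 * v\<^sup>2 * real n) \<le> \<epsilon> / 640"
  shows "real (nL + 1) ^ T * (((real (T + 1))\<^sup>2) ^ n) ^ (nL + 1)
      * exp (- (\<epsilon> / 2 * T * (d\<^sup>2 * (v * n / nL)) / 16)) \<le> exp (- real T)"
proof -
  define D where "D = d\<^sup>2 * (v * n / nL)"
  have lnT: "0 \<le> ln (real T)" using T by simp
  have lnnL: "1 \<le> ln (real nL)"
  proof -
    have "exp 1 \<le> real nL" using exp_le nL by simp
    then show ?thesis using nL by (simp add: ln_ge_iff)
  qed
  have nL_pow: "real nL \<le> real nL ^ 8" "real nL ^ 2 \<le> real nL ^ 5"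
    using nL power_increasing[of 1 8 "real nL"] power_increasing[of 2 5 "real nL"] by auto
  have dv: "d ^ 4 * v\<^sup>2 \<le> d\<^sup>2 * v"
    using d v power_decreasing[of 2 4 d] power_decreasing[of 1 2 v] by (intro mult_mono) auto
  have D1: "ln (real nL) \<le> \<epsilon> / 640 * D"
  proof -
    have "real nL * ln (real nL) \<le> real nL ^ 8 * ln (real nL)"
      using nL_pow lnnL by (intro mult_right_mono) auto
    also have "\<dots> \<le> \<epsilon> / 640 * (d ^ 4 * v\<^sup>2 * real n)"
      using r3 d v n by (subst (asm) pos_divide_le_eq) auto
    also have "\<dots> \<le> \<epsilon> / 640 * (d\<^sup>2 * v * real n)"
      using dv \<epsilon> by (intro mult_left_mono mult_right_mono) auto
    finally show ?thesis using nL by (simp add: D_def field_simps)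
  qed
  have D2: "real nL * real n * ln (real T) \<le> \<epsilon> / 640 * (T * D)"
  proof -
    have "real nL ^ 2 * ln (real T) \<le> real nL ^ 5 * ln (real T)"
      using nL_pow lnT by (intro mult_right_mono) auto
    also have "\<dots> \<le> \<epsilon> / 640 * (d\<^sup>2 * v * real T)"
      using r2 d v T by (subst (asm) pos_divide_le_eq) auto
    finally have "real nL ^ 2 * ln (real T) * (real n / real nL) \<le> \<epsilon> / 640 * (d\<^sup>2 * v * real T) * (real n / real nL)"
      by (rule mult_right_mono) simp
    then show ?thesis using nL by (simp add: D_def field_simps power2_eq_square)
  qed
  \<comment> \<open>In units of \<open>\<epsilon> / 640 * T * D\<close> the assignments cost 2, the
    grid 8 and the final \<open>T\<close> costs 1, while the exponent offers
    \<open>640 / 32 = 20\<close>.\<close>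
  have "real T * ln (real nL + 1) \<le> real T * (2 * ln (real nL))"
    using ln_Suc_le[of nL] nL by (intro mult_left_mono) auto
  moreover have "real (nL + 1) * (real n * (2 * ln (real T + 1))) \<le> (2 * real nL) * (real n * (2 * (2 * ln (real T))))"
    using ln_Suc_le[of T] nL T by (intro mult_mono mult_left_mono) auto
  moreover have "real T * ln (real nL) \<le> real T * (\<epsilon> / 640 * D)"
    using D1 by (intro mult_left_mono) auto
  moreover have "real T \<le> real T * ln (real nL)"
    using lnnL mult_left_mono[of 1 "ln (real nL)" "real T"] by simp
  ultimately have "real T * ln (real nL + 1) + real (nL + 1) * (real n * (2 * ln (real T + 1))) - \<epsilon> / 2 * T * D / 16
      \<le> - real T"
    using D2 by (simp add: algebra_simps)
  moreover have "real (nL + 1) ^ T = exp (real T * ln (real nL + 1))"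
    by (simp add: exp_of_nat_mult add.commute)
  moreover have "(((real (T + 1))\<^sup>2) ^ n) ^ (nL + 1) = exp (real (nL + 1) * (real n * (2 * ln (real T + 1))))"
    unfolding exp_of_nat_mult by (simp add: exp_double add.commute)
  ultimately show ?thesis
    unfolding D_def[symmetric] by (simp add: exp_add[symmetric])
qed

lemma smallo_one_eventually_le:
  fixes f :: "nat \<Rightarrow> real"
  assumes "f \<in> o(\<lambda>_. 1)" "0 < c"
  shows "\<forall>\<^sub>F k in sequentially. f k \<le> c"
  using landau_o.smallD[OF assms] by (auto elim!: eventually_mono)

section \<open>Convergence in probability along the sequence\<close>

theorem theorem9:
  fixes nL n T :: "nat \<Rightarrow> nat"
    and \<rho> :: "nat \<Rightarrow> nat pmf"
    and A :: "nat \<Rightarrow> nat \<Rightarrow> nat \<Rightarrow> real"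
    and d v :: "nat \<Rightarrow> real"
    and c_min c_max c\<^sub>0 :: real
    and z_hat :: "nat \<Rightarrow> (nat \<Rightarrow> nat \<Rightarrow> bool) \<Rightarrow> nat \<Rightarrow> nat"
  assumes model: "\<And>k. hub_model (nL k) (n k) (\<rho> k) (A k)"
    and nL_lim: "filterlim nL at_top sequentially"
    and n_lim: "filterlim n at_top sequentially"
    and T_lim: "filterlim T at_top sequentially"
    and constants_pos: "c_min > 0" "c_max > 0" "c\<^sub>0 > 0"
    and rho_min: "\<And>k. Min ((\<lambda>i. pmf (\<rho> k) i) ` {0..nL k}) = c_min / real (nL k)"
    and rho_max: "\<And>k. Max ((\<lambda>i. pmf (\<rho> k) i) ` {0..nL k}) = c_max / real (nL k)"
    and d_range: "\<And>k. 0 < d k \<and> d k \<le> 1"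
    and v_range: "\<And>k. 0 < v k \<and> v k \<le> 1"
    and separation: "\<And>k i. i \<in> {1..nL k} \<Longrightarrow>
          \<exists>V\<subseteq>{1..n k}. real (card V) \<ge> v k * real (n k) / real (nL k) \<and>
             (\<forall>j\<in>V. \<forall>i'\<in>{0..nL k}. i' \<noteq> i \<longrightarrow> A k i j - A k i' j \<ge> d k)"
    and leaders: "\<And>k i i'. i \<in> {0..nL k} \<Longrightarrow> i' \<in> {1..nL k} \<Longrightarrow> i \<noteq> i' \<Longrightarrow>
          A k i i' \<le> c\<^sub>0 / real (nL k)"
    and rate1: "(\<lambda>k. (real (nL k))^2 * ln (real (nL k)) / real (T k)) \<in> o(\<lambda>_. 1)"
    and rate2: "(\<lambda>k. (real (nL k))^5 * ln (real (T k)) / ((d k)^2 * v k * real (T k))) \<in> o(\<lambda>_. 1)"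
    and rate3: "(\<lambda>k. (real (nL k))^8 * ln (real (nL k)) / ((d k)^4 * (v k)^2 * real (n k))) \<in> o(\<lambda>_. 1)"
    and mle: "\<And>k G. profile_mle (T k) (nL k) (n k) G (z_hat k G)"
  shows "is_op_one (\<lambda>k. measure_pmf (hub_sample_pmf (T k) (n k) (\<rho> k) (A k)))
           (\<lambda>k \<omega>. real (num_mislabeled (T k) (true_labels \<omega>) (z_hat k (observed_groups \<omega>)))
                   / real (T k))"
  unfolding is_op_one_def
proof (intro allI impI)
  fix \<epsilon> :: real assume \<epsilon>: "0 < \<epsilon>"
  let ?X = "\<lambda>k \<omega>. real (num_mislabeled (T k) (true_labels \<omega>) (z_hat k (observed_groups \<omega>))) / real (T k)"
  let ?P = "\<lambda>k. measure_pmf (hub_sample_pmf (T k) (n k) (\<rho> k) (A k))"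
  \<comment> \<open>A common constant: both \<open>q0\<close> and \<open>q1\<close> below are at
    least \<open>c / nL\<^sup>2\<close>.\<close>
  define c where "c = min c_max (c_max * c\<^sub>0)"
  have c: "0 < c" "c \<le> c_max" "c \<le> c_max * c\<^sub>0" using constants_pos by (auto simp: c_def)
  have pos_bounds: "0 < c / 3" "0 < \<epsilon> / 640" using c \<epsilon> by auto
  have nL_inf: "filterlim (\<lambda>k. real (nL k)) at_top sequentially"
    by (rule filterlim_compose[OF filterlim_real_sequentially nL_lim])
  have T_inf: "filterlim (\<lambda>k. real (T k)) at_top sequentially"
    by (rule filterlim_compose[OF filterlim_real_sequentially T_lim])
  \<comment> \<open>The term \<open>4 / nL\<close> pays for the two count events and
    \<open>exp (- T)\<close> for the union bound. The lower bound imposed on \<open>nL\<close> makes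
    the count terms at most half of \<open>\<epsilon> * T\<close>.\<close>
  have "\<forall>\<^sub>F k in sequentially. measure (?P k) {\<omega>\<in>space (?P k). \<bar>?X k \<omega>\<bar> > \<epsilon>}
      \<le> 4 / real (nL k) + exp (- real (T k))"
    using filterlim_at_top[THEN iffD1, OF nL_lim, rule_format, of 3]
      filterlim_at_top[THEN iffD1, OF T_lim, rule_format, of 2]
      filterlim_at_top[THEN iffD1, OF nL_inf, rule_format, of "6 * c_max * (1 + c\<^sub>0) / \<epsilon>"]
      smallo_one_eventually_le[OF rate1 pos_bounds(1)]
      smallo_one_eventually_le[OF rate2 pos_bounds(2)]
      smallo_one_eventually_le[OF rate3 pos_bounds(2)]
  proof eventually_elim
    case (elim k)
    then have nL: "3 \<le> nL k" and T: "2 \<le> T k" and large: "6 * c_max * (1 + c\<^sub>0) / \<epsilon> \<le> real (nL k)"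
      and r1: "(real (nL k))^2 * ln (real (nL k)) / real (T k) \<le> c / 3"
      and r2: "(real (nL k))^5 * ln (real (T k)) / ((d k)^2 * v k * real (T k)) \<le> \<epsilon> / 640"
      and r3: "(real (nL k))^8 * ln (real (nL k)) / ((d k)^4 * (v k)^2 * real (n k)) \<le> \<epsilon> / 640"
      by blast+
    note md = hub_modelD[OF model[of k]]
    have n: "0 < n k" using md(5) nL by simp
    \<comment> \<open>\<open>q0\<close> bounds a label probability, \<open>q1\<close> the
      probability of a label together with a wrong leader, and \<open>m\<close> is the other half of
      the budget \<open>\<epsilon> * T\<close>.\<close>
    define q0 q1 D m where "q0 = c_max / nL k" and "q1 = c_max * c\<^sub>0 / (nL k)\<^sup>2"
      and "D = (d k)\<^sup>2 * (v k * n k / nL k)" and "m = \<epsilon> / 2 * T k"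
    have D: "0 < D" using d_range[of k] v_range[of k] n nL by (simp add: D_def)
    have q0: "pmf (\<rho> k) i \<le> q0" if "i \<in> {0..nL k}" for i
      using Max_ge[of "(\<lambda>i. pmf (\<rho> k) i) ` {0..nL k}" "pmf (\<rho> k) i"] that by (simp add: rho_max q0_def)
    have q1: "pmf (\<rho> k) i * A k i a \<le> q1" if "i \<in> {0..nL k}" "a \<in> {1..nL k}" "i \<noteq> a" for i a
    proof -
      have "a \<in> {1..n k}" using that md(5) by auto
      then have "pmf (\<rho> k) i * A k i a \<le> q0 * (c\<^sub>0 / nL k)"
        using q0 leaders that md(1) constants_pos by (intro mult_mono) (auto simp: q0_def)
      then show ?thesis by (simp add: q0_def q1_def power2_eq_square)
    qed
    have sep: "D \<le> (\<Sum>j=1..n k. (A k i j - A k i' j)\<^sup>2)"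
      if "i \<in> {0..nL k}" "i' \<in> {0..nL k}" "i \<noteq> i'" for i i'
      unfolding D_def using d_range[of k] separation that by (intro row_separation) auto
    \<comment> \<open>The bound \<open>c / 3\<close> on the first rate gives
      \<open>q * T \<ge> 3 * ln nL\<close>; the resulting cube outweighs the roughly
      \<open>nL\<^sup>2\<close> count events.\<close>
    have nL_exp: "exp (- (q * T k)) \<le> 1 / real (nL k) ^ 3" if q: "c / (nL k)\<^sup>2 \<le> q" for q
    proof -
      have "3 * ln (real (nL k)) \<le> c / (nL k)\<^sup>2 * T k"
        using r1 nL T by (simp add: field_simps)
      also have "\<dots> \<le> q * T k" using q by (intro mult_right_mono) auto
      finally have "exp (- (q * T k)) \<le> exp (- ln (real (nL k) ^ 3))"
        using nL by (simp add: ln_realpow)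
      then show ?thesis using nL by (simp add: exp_minus inverse_eq_divide)
    qed
    have "c / (nL k)\<^sup>2 \<le> q0"
      unfolding q0_def using c constants_pos nL self_le_power[of "real (nL k)" 2] by (intro frac_le) auto
    then have e0: "(nL k + 1) * exp (- (q0 * T k)) \<le> (nL k + 1) * (1 / real (nL k) ^ 3)"
      by (intro mult_left_mono nL_exp) auto
    have "c / (nL k)\<^sup>2 \<le> q1"
      unfolding q1_def using c by (intro divide_right_mono) auto
    then have e1: "((nL k + 1) * nL k) * exp (- (q1 * T k)) \<le> ((nL k + 1) * nL k) * (1 / real (nL k) ^ 3)"
      by (intro mult_left_mono nL_exp) auto
    have e01: "(nL k + 1) * (1 / real (nL k) ^ 3) + ((nL k + 1) * nL k) * (1 / real (nL k) ^ 3) \<le> 4 / nL k"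
    proof -
      have "(nL k + 1) * (1 / real (nL k) ^ 3) + ((nL k + 1) * nL k) * (1 / real (nL k) ^ 3)
          = (real (nL k) + 1)\<^sup>2 / real (nL k) ^ 3"
        by (simp add: add_divide_distrib[symmetric] power2_eq_square algebra_simps)
      also have "\<dots> \<le> (2 * real (nL k))\<^sup>2 / real (nL k) ^ 3"
        using nL by (intro divide_right_mono power_mono) auto
      also have "\<dots> = 4 / nL k" using nL by (simp add: power2_eq_square power3_eq_cube)
      finally show ?thesis .
    qed
    have e2: "(nL k + 1) ^ T k * ((((T k + 1)\<^sup>2) ^ n k) ^ (nL k + 1)) * exp (- (m * D / 16)) \<le> exp (- real (T k))"
      using union_bound_le_exp[OF nL n T _ _ _ _ \<epsilon> r2 r3] d_range[of k] v_range[of k]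
      unfolding m_def D_def by simp
    \<comment> \<open>Summed over the \<open>nL\<close> hub classes, the \<open>q1\<close> term is
      of order \<open>1 / nL\<close>, the same as \<open>q0\<close>.\<close>
    have thr: "m + 3 * q0 * T k + nL k * (3 * q1 * T k) \<le> \<epsilon> * T k"
    proof -
      have "3 * q0 + nL k * (3 * q1) = 3 * c_max * (1 + c\<^sub>0) / nL k"
        using nL by (simp add: q0_def q1_def field_simps power2_eq_square)
      also have "\<dots> \<le> \<epsilon> / 2" using large nL \<epsilon> by (simp add: field_simps)
      finally have "(3 * q0 + nL k * (3 * q1)) * T k \<le> \<epsilon> / 2 * T k"
        by (rule mult_right_mono) simp
      then show ?thesis by (simp add: m_def algebra_simps)
    qed
    have "measure (?P k) {\<omega>\<in>space (?P k). \<bar>?X k \<omega>\<bar> > \<epsilon>}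
        \<le> measure (?P k) {\<omega>. m + 3 * q0 * T k + nL k * (3 * q1 * T k)
            < real (num_mislabeled (T k) (true_labels \<omega>) (z_hat k (observed_groups \<omega>)))}"
      using thr T by (intro measure_pmf.finite_measure_mono) (auto simp: less_divide_eq)
    also have "\<dots> \<le> (nL k + 1) * exp (- (q0 * T k)) + ((nL k + 1) * nL k) * exp (- (q1 * T k))
        + (nL k + 1) ^ T k * ((((T k + 1)\<^sup>2) ^ n k) ^ (nL k + 1)) * exp (- (m * D / 16))"
      by (rule prob_mislabeled_le[OF model D sep q0 q1 mle])
    also have "\<dots> \<le> (nL k + 1) * (1 / real (nL k) ^ 3) + ((nL k + 1) * nL k) * (1 / real (nL k) ^ 3)
        + exp (- real (T k))"
      by (intro add_mono e0 e1 e2)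
    also have "\<dots> \<le> 4 / nL k + exp (- real (T k))"
      by (rule add_right_mono[OF e01])
    finally show ?case .
  qed
  moreover have "(\<lambda>k. 4 / real (nL k) + exp (- real (T k))) \<longlonglongrightarrow> 0"
  proof (rule tendsto_add_zero)
    show "(\<lambda>k. 4 / real (nL k)) \<longlonglongrightarrow> 0"
      by (rule tendsto_divide_0[OF tendsto_const filterlim_at_top_imp_at_infinity[OF nL_inf]])
    have "filterlim (\<lambda>k. - real (T k)) at_bot sequentially"
      using T_inf by (simp only: filterlim_uminus_at_bot minus_minus)
    then show "(\<lambda>k. exp (- real (T k))) \<longlonglongrightarrow> 0"
      by (rule filterlim_compose[OF exp_at_bot])
  qed
  ultimately show "(\<lambda>k. measure (?P k) {\<omega>\<in>space (?P k). \<bar>?X k \<omega>\<bar> > \<epsilon>}) \<longlonglongrightarrow> 0"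
    by (rule tendsto_sandwich[OF always_eventually[OF allI[OF measure_nonneg]] _ tendsto_const])
qed

end
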